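(* Let $M$ be a matrix dilation of the form $\begin{pmatrix}\gamma_1&0\\0&\gamma_2\end{pmatrix}$ or $\begin{pmatrix}0&\gamma_1\\\gamma_2&0\end{pmatrix}$ with $\gamma_1,\gamma_2\in\mathbb Z$, let $n\in\mathbb N$, $c\in\frac12\mathbb Z^2$, and let a mask $m_0$ be axial symmetric with respect to the center $c$ and have sum rule of order $n$ (with respect to $M$). Then there exists a mask $\widetilde m_0$ that is axial symmetric with respect to the center $c$ and satisfies $$D^\beta\big(1-m_0(\xi)\overline{\widetilde m_0(\xi)}\big)\Big|_{\xi=\mathbf 0}=0\qquad\forall\beta\in\Delta_n.$$
   Context: A matrix dilation $M$ is an integer matrix all of whose eigenvalues are bigger than 1 in modulus; $M^*$ is its conjugate (transpose). $\Delta_n=\{\alpha\in\mathbb Z^2_+:\alpha_1+\alpha_2<n\}$. A mask is a trigonometric polynomial $m_0(\xi)=\sum_{k\in\mathbb Z^2}h_ke^{2\pi i(k,\xi)}$ (finite sum, $h_k\in\mathbb C$, $\xi\in\mathbb R^2$) with $m_0(\mathbf 0)=1$. The axial symmetry group is $G^{axis}=\{\pm I_2,\pm Y\}$, $Y=\begin{pmatrix}-1&0\\0&1\end{pmatrix}$. A trigonometric polynomial $t$ is axial symmetric with respect to a center $c\in\frac12\mathbb Z^2$ if $t(\xi)=e^{2\pi i(c-Ec,\xi)}t(E^*\xi)$ for all $E\in G^{axis}$. $t$ has sum rule of order $n$ with respect to $M$ if $D^\beta(t(M^{*-1}\xi))|_{\xi=s}=0$ for all $s\in D(M^* )\setminus\{\mathbf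 0\}$ and all $\beta\in\Delta_n$, where $D(M^* )$ is a complete set of representatives of $\mathbb Z^2/M^*\mathbb Z^2$ containing $\mathbf 0$. *)

theory Defs
  imports "HOL-Analysis.Analysis"
begin

definition vec_of_int :: "int^2 \<Rightarrow> real^2" where
  "vec_of_int k = (\<chi> i. of_int (k $ i))"

definition mat_of_int :: "int^2^2 \<Rightarrow> ('a::ring_1)^2^2" where
  "mat_of_int A = map_matrix of_int A"

definition eigenvalue :: "complex^2^2 \<Rightarrow> complex \<Rightarrow> bool" where
  "eigenvalue A z \<longleftrightarrow> (\<exists>v. v \<noteq> 0 \<and> A *v v = z *s v)"

definition matrix_dilation :: "int^2^2 \<Rightarrow> bool" where
  "matrix_dilation M \<longleftrightarrow> (\<forall>z. eigenvalue (mat_of_int M) z \<longrightarrow> cmod z > 1)"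

definition trig_poly :: "(real^2 \<Rightarrow> complex) \<Rightarrow> bool" where
  "trig_poly t \<longleftrightarrow> (\<exists>h :: int^2 \<Rightarrow> complex. finite {k. h k \<noteq> 0} \<and>
     (\<forall>\<xi>. t \<xi> = (\<Sum>k | h k \<noteq> 0.
        h k * exp (2 * of_real pi * \<i> * of_real (vec_of_int k \<bullet> \<xi>)))))"

definition refinement_mask :: "(real^2 \<Rightarrow> complex) \<Rightarrow> bool" where
  "refinement_mask t \<longleftrightarrow> trig_poly t \<and> t 0 = 1"

text \<open>The derivative is a genuine partial derivative only where \<open>f\<close> is differentiable in
  the given direction; \<open>vector_derivative\<close> is unspecified otherwise.\<close>

definition partial_deriv :: "2 \<Rightarrow> (real^2 \<Rightarrow> complex) \<Rightarrow> real^2 \<Rightarrow> complex" where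
  "partial_deriv i f x = vector_derivative (\<lambda>t::real. f (x + t *\<^sub>R axis i 1)) (at 0)"

definition multi_deriv :: "nat \<times> nat \<Rightarrow> (real^2 \<Rightarrow> complex) \<Rightarrow> real^2 \<Rightarrow> complex" where
  "multi_deriv \<beta> f = (partial_deriv 1 ^^ fst \<beta>) ((partial_deriv 2 ^^ snd \<beta>) f)"

definition Delta :: "nat \<Rightarrow> (nat \<times> nat) set" where
  "Delta n = {\<alpha>. fst \<alpha> + snd \<alpha> < n}"

definition half_lattice :: "(real^2) set" where
  "half_lattice = {(1/2) *\<^sub>R vec_of_int k | k. True}"

definition axis_reflection :: "int^2^2" where
  "axis_reflection = vector [vector [-1, 0], vector [0, 1]]"

definition G_axis :: "(int^2^2) set" where
  "G_axis = {mat 1, - mat 1, axis_reflection, - axis_reflection}"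

definition axial_symmetric :: "(real^2 \<Rightarrow> complex) \<Rightarrow> real^2 \<Rightarrow> bool" where
  "axial_symmetric t c \<longleftrightarrow> (\<forall>E \<in> G_axis. \<forall>\<xi>.
     t \<xi> = exp (2 * of_real pi * \<i> * of_real ((c - mat_of_int E *v c) \<bullet> \<xi>))
            * t (mat_of_int (transpose E) *v \<xi>))"

definition digit_set :: "int^2^2 \<Rightarrow> (int^2) set \<Rightarrow> bool" where
  "digit_set A D \<longleftrightarrow> 0 \<in> D \<and> (\<forall>k. \<exists>!s. s \<in> D \<and> (\<exists>l. k - s = A *v l))"

text \<open>\<open>D\<close> is the chosen set of representatives of the integer lattice modulo the transpose
  of \<open>M\<close>.\<close>

definition sum_rule :: "(real^2 \<Rightarrow> complex) \<Rightarrow> int^2^2 \<Rightarrow> (int^2) set \<Rightarrow> nat \<Rightarrow> bool" where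
  "sum_rule t M D n \<longleftrightarrow> (\<forall>s \<in> D - {0}. \<forall>\<beta> \<in> Delta n.
     multi_deriv \<beta> (\<lambda>\<xi>. t (matrix_inv (mat_of_int (transpose M)) *v \<xi>)) (vec_of_int s) = 0)"

end

theory Submission
  imports Defs
begin

text \<open>
  The symmetry group is finite and fixes the origin, so a symmetric mask can be inverted up to a
  prescribed order by a truncated geometric series, provided that one symmetric mask \<open>r\<close> is
  available to start it.  Averaging the constant mask over the group gives such an \<open>r\<close>: it is
  the mean of the exponentials with frequencies \<open>c - E c\<close>, and these frequencies are integral
  because \<open>c\<close> is a half-integral point (lemma \<open>integral_displacement\<close>).

  The phase factors of two functions with the same center are equal and unimodular, hence cancel in
  \<open>m\<^sub>0 * cnj r\<close>.  So \<open>u = 1 - m\<^sub>0 * cnj r\<close> is an invariant trigonometric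
  polynomial that vanishes at the origin, and
  \<open>m = r * (\<Sum>j\<le>n. cnj u ^ j)\<close> is a symmetric mask with the same center.  The geometric sum
  formula yields \<open>1 - m\<^sub>0 * cnj m = u ^ (n + 1)\<close>, and by the Leibniz rule every derivative
  of order at most \<open>n\<close> of this power keeps a factor \<open>u\<close>
  (lemma \<open>multi_deriv_power_eq_0\<close>).
\<close>

section \<open>The algebra of trigonometric polynomials\<close>

definition wave :: "real^2 \<Rightarrow> real^2 \<Rightarrow> complex" where
  "wave v \<xi> = exp (2 * of_real pi * \<i> * of_real (v \<bullet> \<xi>))"

lemma wave_add: "wave (v + w) \<xi> = wave v \<xi> * wave w \<xi>"
  by (simp add: wave_def inner_add_left ring_distribs exp_add)

lemma wave_0_left [simp]: "wave 0 \<xi> = 1"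
  by (simp add: wave_def)

lemma wave_0_right [simp]: "wave v 0 = 1"
  by (simp add: wave_def)

lemma cnj_wave: "cnj (wave v \<xi>) = wave (- v) \<xi>"
  by (simp add: wave_def exp_cnj)

lemma wave_mult_cnj: "wave v \<xi> * cnj (wave v \<xi>) = 1"
  by (simp add: cnj_wave flip: wave_add)

lemma vec_of_int_add: "vec_of_int (k + l) = vec_of_int k + vec_of_int l"
  by (simp add: vec_of_int_def vec_eq_iff)

lemma vec_of_int_uminus: "vec_of_int (- k) = - vec_of_int k"
  by (simp add: vec_of_int_def vec_eq_iff)

lemma vec_of_int_0 [simp]: "vec_of_int 0 = 0"
  by (simp add: vec_of_int_def vec_eq_iff)

text \<open>The summation may run over any finite superset of the support of the coefficients; this
  makes closure under addition a matter of enlarging index sets.\<close>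

lemma trig_poly_iff:
  "trig_poly t \<longleftrightarrow>
    (\<exists>S h. finite S \<and> t = (\<lambda>\<xi>. \<Sum>k\<in>S. h k * wave (vec_of_int k) \<xi>))"
proof
  assume "trig_poly t"
  then obtain h where "finite {k. h k \<noteq> 0}"
    "\<And>\<xi>. t \<xi> = (\<Sum>k | h k \<noteq> 0. h k * wave (vec_of_int k) \<xi>)"
    unfolding trig_poly_def wave_def [symmetric] by (elim exE conjE) (rule that, simp_all)
  then show "\<exists>S h. finite S \<and> t = (\<lambda>\<xi>. \<Sum>k\<in>S. h k * wave (vec_of_int k) \<xi>)"
    by (intro exI [of _ "{k. h k \<noteq> 0}"] exI [of _ h]) auto
next
  assume "\<exists>S h. finite S \<and> t = (\<lambda>\<xi>. \<Sum>k\<in>S. h k * wave (vec_of_int k) \<xi>)"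
  then obtain S h where S: "finite S"
    and t: "t = (\<lambda>\<xi>. \<Sum>k\<in>S. h k * wave (vec_of_int k) \<xi>)" by blast
  define g where "g k = (if k \<in> S then h k else 0)" for k
  have sub: "{k. g k \<noteq> 0} \<subseteq> S"
    by (auto simp: g_def)
  have "t \<xi> = (\<Sum>k | g k \<noteq> 0. g k * wave (vec_of_int k) \<xi>)" for \<xi>
    unfolding t by (rule sum.mono_neutral_cong_right [OF S sub]) (auto simp: g_def)
  moreover have "finite {k. g k \<noteq> 0}"
    using sub S by (rule finite_subset)
  ultimately show "trig_poly t"
    unfolding trig_poly_def wave_def [symmetric] by (intro exI [of _ g]) simp
qed

lemma trig_poly_monomial: "trig_poly (\<lambda>\<xi>. a * wave (vec_of_int k) \<xi>)"
  unfolding trig_poly_iff by (rule exI [of _ "{k}"], rule exI [of _ "\<lambda>_. a"]) simp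

lemma trig_poly_add:
  assumes "trig_poly f" "trig_poly g"
  shows "trig_poly (\<lambda>\<xi>. f \<xi> + g \<xi>)"
proof -
  obtain S h T l where S: "finite S" "f = (\<lambda>\<xi>. \<Sum>k\<in>S. h k * wave (vec_of_int k) \<xi>)"
    and T: "finite T" "g = (\<lambda>\<xi>. \<Sum>k\<in>T. l k * wave (vec_of_int k) \<xi>)"
    using assms unfolding trig_poly_iff by blast
  define q where "q k = (if k \<in> S then h k else 0) + (if k \<in> T then l k else 0)" for k
  have "f \<xi> + g \<xi> = (\<Sum>k\<in>S \<union> T. q k * wave (vec_of_int k) \<xi>)" for \<xi>
  proof -
    have "f \<xi> = (\<Sum>k\<in>S \<union> T. (if k \<in> S then h k else 0) * wave (vec_of_int k) \<xi>)"
      unfolding S(2) by (rule sum.mono_neutral_cong_left) (use S T in auto)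
    moreover have "g \<xi> = (\<Sum>k\<in>S \<union> T. (if k \<in> T then l k else 0) * wave (vec_of_int k) \<xi>)"
      unfolding T(2) by (rule sum.mono_neutral_cong_left) (use S T in auto)
    ultimately show ?thesis
      by (simp add: q_def distrib_right sum.distrib)
  qed
  then show ?thesis
    unfolding trig_poly_iff using S(1) T(1) by (intro exI [of _ "S \<union> T"] exI [of _ q]) auto
qed

lemma trig_poly_0: "trig_poly (\<lambda>_. 0)"
  using trig_poly_monomial [of 0] by simp

lemma trig_poly_const: "trig_poly (\<lambda>_. a)"
  using trig_poly_monomial [of a 0] by simp

lemma trig_poly_induct [consumes 1, case_names zero add]:
  assumes "trig_poly t"
    and zero: "P (\<lambda>_. 0)"
    and add: "\<And>a k f. P f \<Longrightarrow> P (\<lambda>\<xi>. a * wave (vec_of_int k) \<xi> + f \<xi>)"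
  shows "P t"
proof -
  obtain S h where "finite S" and t: "t = (\<lambda>\<xi>. \<Sum>k\<in>S. h k * wave (vec_of_int k) \<xi>)"
    using assms(1) unfolding trig_poly_iff by blast
  from \<open>finite S\<close> show ?thesis
    unfolding t by induction (simp_all add: zero add)
qed

lemma trig_poly_mult_monomial:
  assumes "trig_poly f"
  shows "trig_poly (\<lambda>\<xi>. a * wave (vec_of_int k) \<xi> * f \<xi>)"
  using assms
proof (induction rule: trig_poly_induct)
  case zero
  show ?case by (simp add: trig_poly_0)
next
  case (add b l f)
  have "trig_poly (\<lambda>\<xi>. a * b * wave (vec_of_int (k + l)) \<xi> + a * wave (vec_of_int k) \<xi> * f \<xi>)"
    by (intro trig_poly_add trig_poly_monomial add)
  then show ?case
    by (simp add: vec_of_int_add wave_add algebra_simps)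
qed

lemma trig_poly_mult:
  assumes "trig_poly f" "trig_poly g"
  shows "trig_poly (\<lambda>\<xi>. f \<xi> * g \<xi>)"
  using assms(1)
proof (induction rule: trig_poly_induct)
  case zero
  show ?case by (simp add: trig_poly_0)
next
  case (add a k f)
  have "trig_poly (\<lambda>\<xi>. a * wave (vec_of_int k) \<xi> * g \<xi> + f \<xi> * g \<xi>)"
    by (intro trig_poly_add trig_poly_mult_monomial add assms)
  then show ?case
    by (simp add: distrib_right)
qed

lemma trig_poly_diff:
  assumes "trig_poly f" "trig_poly g"
  shows "trig_poly (\<lambda>\<xi>. f \<xi> - g \<xi>)"
  using trig_poly_add [OF assms(1) trig_poly_mult [OF trig_poly_const [of "- 1"] assms(2)]]
  by simp

lemma trig_poly_cnj:
  assumes "trig_poly f"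
  shows "trig_poly (\<lambda>\<xi>. cnj (f \<xi>))"
  using assms
proof (induction rule: trig_poly_induct)
  case zero
  show ?case by (simp add: trig_poly_0)
next
  case (add a k f)
  have "trig_poly (\<lambda>\<xi>. cnj a * wave (vec_of_int (- k)) \<xi> + cnj (f \<xi>))"
    by (intro trig_poly_add trig_poly_monomial add)
  then show ?case
    by (simp add: cnj_wave vec_of_int_uminus)
qed

lemma trig_poly_power:
  assumes "trig_poly f"
  shows "trig_poly (\<lambda>\<xi>. f \<xi> ^ j)"
  by (induction j) (simp_all add: trig_poly_const trig_poly_mult assms)

lemma trig_poly_sum:
  assumes "\<And>x. x \<in> A \<Longrightarrow> trig_poly (f x)"
  shows "trig_poly (\<lambda>\<xi>. \<Sum>x\<in>A. f x \<xi>)"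
  using assms
  by (induction A rule: infinite_finite_induct) (simp_all add: trig_poly_0 trig_poly_add)

section \<open>Derivatives of powers\<close>

text \<open>Unlike the function \<^const>\<open>partial_deriv\<close>, this relation entails that the derivative exists,
  which the product rule needs.\<close>

definition has_partial_deriv ::
    "(real^2 \<Rightarrow> complex) \<Rightarrow> (real^2 \<Rightarrow> complex) \<Rightarrow> 2 \<Rightarrow> bool" where
  "has_partial_deriv f f' i \<longleftrightarrow>
    (\<forall>x. ((\<lambda>t. f (x + t *\<^sub>R axis i 1)) has_vector_derivative f' x) (at 0))"

lemma partial_deriv_eqI: "has_partial_deriv f f' i \<Longrightarrow> partial_deriv i f = f'"
  unfolding has_partial_deriv_def partial_deriv_def
  by (auto intro: vector_derivative_at)

lemma has_partial_deriv_mult: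
  assumes "has_partial_deriv f f' i" "has_partial_deriv g g' i"
  shows "has_partial_deriv (\<lambda>x. f x * g x) (\<lambda>x. f x * g' x + f' x * g x) i"
  unfolding has_partial_deriv_def
proof
  fix x
  have "((\<lambda>t. f (x + t *\<^sub>R axis i 1)) has_vector_derivative f' x) (at 0)"
    "((\<lambda>t. g (x + t *\<^sub>R axis i 1)) has_vector_derivative g' x) (at 0)"
    using assms unfolding has_partial_deriv_def by blast+
  from has_vector_derivative_mult [OF this]
  show "((\<lambda>t. f (x + t *\<^sub>R axis i 1) * g (x + t *\<^sub>R axis i 1))
      has_vector_derivative f x * g' x + f' x * g x) (at 0)"
    by simp
qed

lemma has_partial_deriv_power_Suc:
  assumes "has_partial_deriv f f' i"
  shows "has_partial_deriv (\<lambda>x. f x ^ Suc j) (\<lambda>x. of_nat (Suc j) * f x ^ j * f' x) i"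
proof (induction j)
  case 0
  show ?case using assms by simp
next
  case (Suc j)
  from has_partial_deriv_mult [OF assms Suc] show ?case
    by (simp add: algebra_simps)
qed

lemma has_partial_deriv_wave:
  "has_partial_deriv (wave v) (\<lambda>x. 2 * of_real pi * \<i> * of_real (v $ i) * wave v x) i"
  unfolding has_partial_deriv_def
proof
  fix x
  let ?c = "2 * of_real pi * \<i> :: complex"
  have "((\<lambda>z. exp (?c * (of_real (v \<bullet> x) + z * of_real (v $ i)))) has_field_derivative
      ?c * of_real (v $ i) * wave v x) (at (of_real 0))"
    by (auto intro!: derivative_eq_intros simp: wave_def)
  then have "((\<lambda>t. exp (?c * (of_real (v \<bullet> x) + of_real t * of_real (v $ i))))
      has_vector_derivative ?c * of_real (v $ i) * wave v x) (at (0::real))"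
    by (rule has_vector_derivative_real_field)
  moreover have "(\<lambda>t. exp (?c * (of_real (v \<bullet> x) + of_real t * of_real (v $ i))))
      = (\<lambda>t. wave v (x + t *\<^sub>R axis i 1))"
    by (auto simp: wave_def inner_add_right inner_axis)
  ultimately show "((\<lambda>t. wave v (x + t *\<^sub>R axis i 1)) has_vector_derivative
      ?c * of_real (v $ i) * wave v x) (at 0)"
    by simp
qed

lemma trig_poly_has_partial_deriv:
  assumes "trig_poly t"
  shows "\<exists>t'. trig_poly t' \<and> has_partial_deriv t t' i"
  using assms
proof (induction rule: trig_poly_induct)
  case zero
  show ?case
    using trig_poly_0 by (auto simp: has_partial_deriv_def intro!: exI [of _ "\<lambda>_. 0"])
next
  case (add a k f)
  then obtain f' where f': "trig_poly f'" "has_partial_deriv f f' i" by blast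
  let ?w = "\<lambda>\<xi>. a * (2 * of_real pi * \<i> * of_real (vec_of_int k $ i)) * wave (vec_of_int k) \<xi>"
  have "trig_poly (\<lambda>\<xi>. ?w \<xi> + f' \<xi>)"
    by (intro trig_poly_add trig_poly_monomial f')
  moreover have "has_partial_deriv (\<lambda>\<xi>. a * wave (vec_of_int k) \<xi> + f \<xi>) (\<lambda>\<xi>. ?w \<xi> + f' \<xi>) i"
    unfolding has_partial_deriv_def
  proof
    fix x
    have "((\<lambda>t. wave (vec_of_int k) (x + t *\<^sub>R axis i 1)) has_vector_derivative
        2 * of_real pi * \<i> * of_real (vec_of_int k $ i) * wave (vec_of_int k) x) (at 0)"
      using has_partial_deriv_wave unfolding has_partial_deriv_def by blast
    from has_vector_derivative_mult_right [OF this, of a]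
    show "((\<lambda>t. a * wave (vec_of_int k) (x + t *\<^sub>R axis i 1) + f (x + t *\<^sub>R axis i 1))
        has_vector_derivative ?w x + f' x) (at 0)"
      using f'(2) unfolding has_partial_deriv_def
      by (intro has_vector_derivative_add) (auto simp: mult.assoc)
  qed
  ultimately show ?case by blast
qed

text \<open>A factor \<open>g\<close> is carried along because differentiation turns a pure power of \<open>u\<close> into a
  power times \<open>u'\<close>; only in this form does the statement iterate.\<close>

lemma partial_deriv_power_mult:
  assumes u: "trig_poly u" and g: "trig_poly g"
  shows "\<exists>g'. trig_poly g' \<and>
    partial_deriv i (\<lambda>x. u x ^ Suc j * g x) = (\<lambda>x. u x ^ j * g' x)"
proof -
  obtain u' where u': "trig_poly u'" "has_partial_deriv u u' i"
    using trig_poly_has_partial_deriv [OF u] by blast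
  obtain g' where g': "trig_poly g'" "has_partial_deriv g g' i"
    using trig_poly_has_partial_deriv [OF g] by blast
  let ?q = "\<lambda>x. u x * g' x + of_nat (Suc j) * u' x * g x"
  have "trig_poly ?q"
    by (intro trig_poly_add trig_poly_mult trig_poly_const u g u'(1) g'(1))
  moreover have "partial_deriv i (\<lambda>x. u x ^ Suc j * g x) = (\<lambda>x. u x ^ j * ?q x)"
    unfolding partial_deriv_eqI
      [OF has_partial_deriv_mult [OF has_partial_deriv_power_Suc [OF u'(2)] g'(2)]]
    by (auto simp: algebra_simps)
  ultimately show ?thesis by blast
qed

lemma partial_deriv_funpow_power_mult:
  assumes u: "trig_poly u" and g: "trig_poly g"
  shows "\<exists>g'. trig_poly g' \<and>
    (partial_deriv i ^^ b) (\<lambda>x. u x ^ (b + j) * g x) = (\<lambda>x. u x ^ j * g' x)"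
  using g
proof (induction b arbitrary: g)
  case 0
  then show ?case by auto
next
  case (Suc b)
  obtain g1 where "trig_poly g1"
    and "partial_deriv i (\<lambda>x. u x ^ Suc (b + j) * g x) = (\<lambda>x. u x ^ (b + j) * g1 x)"
    using partial_deriv_power_mult [OF u Suc.prems] by blast
  with Suc.IH [of g1] show ?case
    by (simp add: funpow_Suc_right del: funpow.simps)
qed

lemma multi_deriv_power_eq_0:
  assumes u: "trig_poly u" "u x = 0" and "fst \<beta> + snd \<beta> < N"
  shows "multi_deriv \<beta> (\<lambda>\<xi>. u \<xi> ^ N) x = 0"
proof -
  define j where "j = N - Suc (fst \<beta> + snd \<beta>)"
  have N: "N = snd \<beta> + (fst \<beta> + Suc j)"
    using assms(3) by (simp add: j_def)
  obtain g where g: "trig_poly g"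
    "(partial_deriv 2 ^^ snd \<beta>) (\<lambda>\<xi>. u \<xi> ^ N) = (\<lambda>\<xi>. u \<xi> ^ (fst \<beta> + Suc j) * g \<xi>)"
    using partial_deriv_funpow_power_mult [OF u(1) trig_poly_const [of 1],
      where i = 2 and b = "snd \<beta>" and j = "fst \<beta> + Suc j"] N by auto
  obtain g' where
    "(partial_deriv 1 ^^ fst \<beta>) (\<lambda>\<xi>. u \<xi> ^ (fst \<beta> + Suc j) * g \<xi>) = (\<lambda>\<xi>. u \<xi> ^ Suc j * g' \<xi>)"
    using partial_deriv_funpow_power_mult [OF u(1) g(1),
      where i = 1 and b = "fst \<beta>" and j = "Suc j"] by blast
  with g(2) u(2) show ?thesis
    by (simp add: multi_deriv_def)
qed

section \<open>The symmetry group and a symmetric mask\<close>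

lemma mat_of_int_mult:
  "(mat_of_int (A ** B) :: real^2^2) = mat_of_int A ** mat_of_int B"
  by (simp add: mat_of_int_def map_matrix_def matrix_matrix_mult_def vec_eq_iff)

lemma mat_of_int_transpose: "(mat_of_int (transpose A) :: real^2^2) = transpose (mat_of_int A)"
  by (simp add: mat_of_int_def map_matrix_def transpose_def vec_eq_iff)

lemma inner_mat_of_int_transpose:
  "v \<bullet> (mat_of_int (transpose E) *v \<xi>) = (mat_of_int E *v v) \<bullet> (\<xi> :: real^2)"
  using dot_lmul_matrix [of \<xi> "mat_of_int E" v]
  by (simp add: mat_of_int_transpose inner_commute)

lemma axis_reflection_square: "axis_reflection ** axis_reflection = mat 1"
  by (simp add: axis_reflection_def matrix_matrix_mult_def mat_def vec_eq_iff forall_2 sum_2)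

lemma minus_matrix_mult:
  fixes A B :: "int^2^2"
  shows "(- A) ** B = - (A ** B)" "A ** (- B) = - (A ** B)"
  by (simp_all add: matrix_matrix_mult_def vec_eq_iff sum_negf)

lemma G_axis_mult: "E \<in> G_axis \<Longrightarrow> F \<in> G_axis \<Longrightarrow> E ** F \<in> G_axis"
  by (auto simp: G_axis_def minus_matrix_mult axis_reflection_square)

lemma G_axis_square: "E \<in> G_axis \<Longrightarrow> E ** E = mat 1"
  by (auto simp: G_axis_def minus_matrix_mult axis_reflection_square)

lemma finite_G_axis: "finite G_axis" and G_axis_nonempty: "G_axis \<noteq> {}"
  by (simp_all add: G_axis_def)

lemma bij_betw_G_axis_mult:
  assumes "E \<in> G_axis"
  shows "bij_betw ((**) E) G_axis G_axis"
  by (rule bij_betw_byWitness [where f' = "(**) E"])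
    (use assms in \<open>auto simp: matrix_mul_assoc G_axis_square G_axis_mult\<close>)

text \<open>Every entry of \<open>c - E c\<close> is \<open>0\<close> or twice an entry of \<open>c\<close>.\<close>

lemma integral_displacement:
  assumes "c \<in> half_lattice" "E \<in> G_axis"
  shows "\<exists>k. c - mat_of_int E *v c = vec_of_int k"
proof -
  obtain l where c: "c = (1/2) *\<^sub>R vec_of_int l"
    using assms(1) by (auto simp: half_lattice_def)
  have E: "E \<in> {mat 1, - mat 1, axis_reflection, - axis_reflection}"
    using assms(2) by (simp add: G_axis_def)
  define k :: "int^2" where
    "k = (\<chi> i. if E $ i $ i = 1 then 0 else l $ i)"
  have diagonal: "E $ 1 $ 1 \<in> {1, - 1}" "E $ 2 $ 2 \<in> {1, - 1}" "E $ 1 $ 2 = 0" "E $ 2 $ 1 = 0"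
    using E by (auto simp: mat_def axis_reflection_def)
  have "c $ i - (mat_of_int E *v c) $ i = vec_of_int k $ i" for i
  proof -
    have "(mat_of_int E *v c) $ i = of_int (E $ i $ i) * c $ i"
      using diagonal exhaust_2 [of i]
      by (auto simp: mat_of_int_def map_matrix_def matrix_vector_mult_def sum_2)
    moreover have "E $ i $ i = 1 \<or> E $ i $ i = - 1"
      using diagonal exhaust_2 [of i] by auto
    ultimately show ?thesis
      by (auto simp: k_def c vec_of_int_def)
  qed
  then show ?thesis
    by (auto simp: vec_eq_iff)
qed

lemma axial_symmetric_iff:
  "axial_symmetric t c \<longleftrightarrow> (\<forall>E \<in> G_axis. \<forall>\<xi>.
     t \<xi> = wave (c - mat_of_int E *v c) \<xi> * t (mat_of_int (transpose E) *v \<xi>))"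
  by (simp add: axial_symmetric_def wave_def)

text \<open>The average of the constant function \<open>1\<close> under the action of the group on functions for
  which the functions with center \<open>c\<close> are the fixed points.  In coordinates it is
  \<open>(1 + exp (4 \<pi> \<i> c\<^sub>1 \<xi>\<^sub>1)) (1 + exp (4 \<pi> \<i> c\<^sub>2 \<xi>\<^sub>2)) / 4\<close>.\<close>

definition mean_mask :: "real^2 \<Rightarrow> real^2 \<Rightarrow> complex" where
  "mean_mask c \<xi> = (\<Sum>E\<in>G_axis. wave (c - mat_of_int E *v c) \<xi>) / of_nat (card G_axis)"

lemma refinement_mask_mean_mask:
  assumes "c \<in> half_lattice"
  shows "refinement_mask (mean_mask c)"
proof -
  have "trig_poly (wave (c - mat_of_int E *v c))" if E: "E \<in> G_axis" for E
    using integral_displacement [OF assms E] trig_poly_monomial [of 1] by auto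
  then have "trig_poly (\<lambda>\<xi>. (\<Sum>E\<in>G_axis. wave (c - mat_of_int E *v c) \<xi>)
      * inverse (of_nat (card G_axis)))"
    by (intro trig_poly_mult trig_poly_sum trig_poly_const)
  then have "trig_poly (mean_mask c)"
    unfolding mean_mask_def [abs_def] by (simp add: divide_inverse)
  moreover have "mean_mask c 0 = 1"
    by (simp add: mean_mask_def finite_G_axis G_axis_nonempty)
  ultimately show ?thesis
    by (simp add: refinement_mask_def)
qed

text \<open>The substitution \<open>\<xi> \<mapsto> E\<^sup>T \<xi>\<close>, followed by multiplication by the phase
  factor, turns the frequency \<open>c - F c\<close> into \<open>c - E F c\<close>; since \<open>F \<mapsto> E F\<close> permutes the
  group, the terms of the mean are only reordered.\<close>

lemma axial_symmetric_mean_mask: "axial_symmetric (mean_mask c) c"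
  unfolding axial_symmetric_iff
proof (intro ballI allI)
  fix E \<xi> assume E: "E \<in> G_axis"
  let ?A = "\<lambda>E. mat_of_int E :: real^2^2"
  let ?\<eta> = "?A (transpose E) *v \<xi>"
  have "wave (c - ?A E *v c) \<xi> * wave (c - ?A F *v c) ?\<eta> = wave (c - ?A (E ** F) *v c) \<xi>" for F
  proof -
    have "wave (c - ?A F *v c) ?\<eta> = wave (?A E *v (c - ?A F *v c)) \<xi>"
      by (simp add: wave_def inner_mat_of_int_transpose)
    then show ?thesis
      by (simp add: mat_of_int_mult matrix_vector_mul_assoc matrix_vector_mult_diff_distrib
          flip: wave_add)
  qed
  then have "wave (c - ?A E *v c) \<xi> * (\<Sum>F\<in>G_axis. wave (c - ?A F *v c) ?\<eta>)
      = (\<Sum>F\<in>G_axis. wave (c - ?A (E ** F) *v c) \<xi>)"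
    by (simp add: sum_distrib_left)
  also have "\<dots> = (\<Sum>F\<in>G_axis. wave (c - ?A F *v c) \<xi>)"
    by (rule sum.reindex_bij_betw [OF bij_betw_G_axis_mult [OF E]])
  finally show "mean_mask c \<xi> = wave (c - ?A E *v c) \<xi> * mean_mask c ?\<eta>"
    by (simp add: mean_mask_def)
qed

section \<open>The dual mask\<close>

theorem theorem25:
  fixes M :: "int^2^2" and \<gamma>\<^sub>1 \<gamma>\<^sub>2 :: int and n :: nat and c :: "real^2"
    and D :: "(int^2) set" and m\<^sub>0 :: "real^2 \<Rightarrow> complex"
  assumes "matrix_dilation M"
    and "M = vector [vector [\<gamma>\<^sub>1, 0], vector [0, \<gamma>\<^sub>2]] \<or>
         M = vector [vector [0, \<gamma>\<^sub>1], vector [\<gamma>\<^sub>2, 0]]"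
    and "c \<in> half_lattice"
    and "digit_set (transpose M) D"
    and "refinement_mask m\<^sub>0"
    and "axial_symmetric m\<^sub>0 c"
    and "sum_rule m\<^sub>0 M D n"
  shows "\<exists>m. refinement_mask m \<and> axial_symmetric m c \<and>
    (\<forall>\<beta> \<in> Delta n. multi_deriv \<beta> (\<lambda>\<xi>. 1 - m\<^sub>0 \<xi> * cnj (m \<xi>)) 0 = 0)"
proof -
  define r where "r = mean_mask c"
  define u where "u \<xi> = 1 - m\<^sub>0 \<xi> * cnj (r \<xi>)" for \<xi>
  \<comment> \<open>Including \<open>j = n\<close> keeps the sum nonempty, hence \<open>m 0 = 1\<close>, also for \<open>n = 0\<close>.\<close>
  define m where "m \<xi> = r \<xi> * (\<Sum>j<Suc n. cnj (u \<xi>) ^ j)" for \<xi>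
  have m0: "trig_poly m\<^sub>0" "m\<^sub>0 0 = 1"
    using assms(5) by (auto simp: refinement_mask_def)
  have r: "trig_poly r" "r 0 = 1"
    using refinement_mask_mean_mask [OF assms(3)] by (auto simp: refinement_mask_def r_def)
  have u: "trig_poly u" "u 0 = 0"
    unfolding u_def [abs_def]
    by (intro trig_poly_diff trig_poly_const trig_poly_mult trig_poly_cnj m0 r)
      (simp add: m0 r)
  have "trig_poly m"
    unfolding m_def [abs_def]
    by (intro trig_poly_mult trig_poly_sum trig_poly_power trig_poly_cnj u r)
  moreover have "m 0 = 1"
    by (simp add: m_def r u power_0_left del: sum.lessThan_Suc)
  ultimately have mask: "refinement_mask m"
    by (simp add: refinement_mask_def)
  have sym: "axial_symmetric m c"
    unfolding axial_symmetric_iff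
  proof (intro ballI allI)
    fix E \<xi> assume E: "E \<in> G_axis"
    let ?\<chi> = "wave (c - mat_of_int E *v c) \<xi>"
    let ?\<eta> = "mat_of_int (transpose E) *v \<xi>"
    have r_eq: "r \<xi> = ?\<chi> * r ?\<eta>"
      using axial_symmetric_mean_mask E unfolding axial_symmetric_iff r_def by blast
    have m0_eq: "m\<^sub>0 \<xi> = ?\<chi> * m\<^sub>0 ?\<eta>"
      using assms(6) E unfolding axial_symmetric_iff by blast
    have "m\<^sub>0 \<xi> * cnj (r \<xi>) = (?\<chi> * cnj ?\<chi>) * (m\<^sub>0 ?\<eta> * cnj (r ?\<eta>))"
      by (subst r_eq, subst m0_eq) simp
    then have "u \<xi> = u ?\<eta>"
      by (simp add: u_def wave_mult_cnj)
    with r_eq show "m \<xi> = ?\<chi> * m ?\<eta>"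
      by (simp add: m_def del: sum.lessThan_Suc)
  qed
  have "1 - m\<^sub>0 \<xi> * cnj (m \<xi>) = u \<xi> ^ Suc n" for \<xi>
  proof -
    have "m\<^sub>0 \<xi> * cnj (m \<xi>) = (1 - u \<xi>) * (\<Sum>j<Suc n. u \<xi> ^ j)"
      by (simp add: m_def u_def del: sum.lessThan_Suc)
    also have "\<dots> = 1 - u \<xi> ^ Suc n"
      by (rule one_diff_power_eq [symmetric])
    finally show ?thesis by simp
  qed
  then have "\<forall>\<beta>\<in>Delta n. multi_deriv \<beta> (\<lambda>\<xi>. 1 - m\<^sub>0 \<xi> * cnj (m \<xi>)) 0 = 0"
    using multi_deriv_power_eq_0 [OF u] by (simp add: Delta_def del: power_Suc)
  with mask sym show ?thesis by blast
qed

end
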